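(* For any lattice $\Lambda\subseteq\mathbb{R}^2$ there is a convergent sequence of angles $\theta_n\in S^1$, $n=1,2,\ldots$, such that the set $\Theta = \overline{\{\theta_n : n=1,2,\ldots\}}$ is $(\Lambda,\epsilon)$-good for all $\epsilon>0$.
   Context: A lattice in $\mathbb{R}^2$ is a discrete subgroup of $\mathbb{R}^2$ of rank 2. $B_\epsilon(0)=\{x\in\mathbb{R}^2:|x|<\epsilon\}$. $S^1$ is the unit circle, identified with the set of angles (mod $2\pi$); convergence and closure are in $S^1$. $R_\theta$ denotes rotation of $\mathbb{R}^2$ about the origin by the angle $\theta$, and $R_\Theta E = \{R_\theta x: \theta\in\Theta, x\in E\}$. A set $\Theta\subseteq S^1$ is called $(\Lambda,\epsilon)$-good if $R_\Theta E$ contains the complement of a disk, where $E=\Lambda+B_\epsilon(0)$. *)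

theory Defs
  imports "HOL-Analysis.Analysis"
begin

definition additive_subgroup :: "'a::ab_group_add set \<Rightarrow> bool" where
  "additive_subgroup G \<longleftrightarrow> 0 \<in> G \<and> (\<forall>x\<in>G. \<forall>y\<in>G. x + y \<in> G) \<and> (\<forall>x\<in>G. - x \<in> G)"

text \<open>Independence is over the integers, not over the reals: the rank below is the rank
  of \<open>G\<close> as an abelian group, i.e. the largest size of a subset independent over the integers.\<close>

abbreviation int_independent :: "'a::real_vector set \<Rightarrow> bool" where
  "int_independent B \<equiv> module.independent (\<lambda>(k::int) x. real_of_int k *\<^sub>R x) B"

definition has_rank :: "'a::real_vector set \<Rightarrow> nat \<Rightarrow> bool" where
  "has_rank G r \<longleftrightarrow>
     (\<exists>B\<subseteq>G. int_independent B \<and> finite B \<and> card B = r) \<and>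
     (\<forall>B\<subseteq>G. int_independent B \<longrightarrow> finite B \<and> card B \<le> r)"

definition lattice2 :: "(real^2) set \<Rightarrow> bool" where
  "lattice2 L \<longleftrightarrow> additive_subgroup L \<and> discrete L \<and> has_rank L 2"

definition rotation :: "real \<Rightarrow> real^2 \<Rightarrow> real^2" where
  "rotation t x = vector [vector [cos t, - sin t], vector [sin t, cos t]] *v x"

text \<open>The unit circle is \<open>sphere 0 1\<close> in the complex plane; the angle \<open>t\<close> (mod \<open>2 * pi\<close>)
  corresponds to the point \<open>cis t\<close>. Since \<open>rotation t\<close> depends only on \<open>cis t\<close>,
  it makes sense to rotate by a point of the circle.\<close>

abbreviation unit_circle :: "complex set" where
  "unit_circle \<equiv> sphere 0 1"

lemma rotation_cong: "cis s = cis t \<Longrightarrow> rotation s = rotation t"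
  by (simp add: rotation_def fun_eq_iff complex_eq_iff)

definition rotate_set :: "complex set \<Rightarrow> (real^2) set \<Rightarrow> (real^2) set" where
  "rotate_set \<Theta> E = {rotation t x | t x. cis t \<in> \<Theta> \<and> x \<in> E}"

definition thicken :: "(real^2) set \<Rightarrow> real \<Rightarrow> (real^2) set" where
  "thicken L \<epsilon> = {x + y | x y. x \<in> L \<and> y \<in> ball 0 \<epsilon>}"

definition good :: "(real^2) set \<Rightarrow> real \<Rightarrow> complex set \<Rightarrow> bool" where
  "good L \<epsilon> \<Theta> \<longleftrightarrow> \<Theta> \<subseteq> unit_circle \<and> (\<exists>c. \<exists>r>0. - ball c r \<subseteq> rotate_set \<Theta> (thicken L \<epsilon>))"

end

theory Submission
  imports Defs
begin

text \<open>Let \<open>\<delta> > 0\<close>. Every circular sector contains a lattice vector \<open>b\<close> for which some lattice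
  vector \<open>a\<close> satisfies \<open>0 < a \<bullet> b < \<delta> * norm b\<close>. Adding \<open>a\<close> repeatedly to a large multiple of
  \<open>b\<close> increases the norm in steps smaller than \<open>\<delta>\<close>, so the norms of the lattice vectors in the
  sector are eventually \<open>\<delta>\<close>-dense. By compactness of the circle, all sufficiently distant points
  are within \<open>\<delta>\<close> of a lattice vector rotated by some \<open>t\<close> with \<open>norm (cis t - 1) < \<delta>\<close>. On a
  compact annulus finitely many such \<open>t\<close> suffice. Apply this with \<open>\<delta> = 1 / (k + 1)\<close> to the \<open>k\<close>-th of a sequence
  of annuli exhausting the plane: the angles used accumulate only at the trivial rotation.\<close>

section \<open>Additive subgroups and real bases of lattices\<close>

lemma additive_subgroup_add: "additive_subgroup G \<Longrightarrow> x \<in> G \<Longrightarrow> y \<in> G \<Longrightarrow> x + y \<in> G"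
  and additive_subgroup_minus: "additive_subgroup G \<Longrightarrow> x \<in> G \<Longrightarrow> - x \<in> G"
  and additive_subgroup_zero: "additive_subgroup G \<Longrightarrow> 0 \<in> G"
  by (auto simp: additive_subgroup_def)

lemma additive_subgroup_scaleR_of_int:
  fixes x :: "'a::real_vector"
  assumes G: "additive_subgroup G" and x: "x \<in> G"
  shows "real_of_int k *\<^sub>R x \<in> G"
proof -
  have nat: "real n *\<^sub>R x \<in> G" for n
  proof (induction n)
    case 0
    show ?case using additive_subgroup_zero[OF G] by simp
  next
    case (Suc n)
    have "real (Suc n) *\<^sub>R x = x + real n *\<^sub>R x" by (simp add: scaleR_left_distrib)
    then show ?case using additive_subgroup_add[OF G x Suc.IH] by simp
  qed
  show ?thesis
  proof (cases k)
    case (nonneg n)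
    then show ?thesis using nat[of n] by simp
  next
    case (neg n)
    have "real_of_int k *\<^sub>R x = - (real (Suc n) *\<^sub>R x)" unfolding neg by (simp flip: scaleR_minus_left)
    then show ?thesis using additive_subgroup_minus[OF G nat[of "Suc n"]] by simp
  qed
qed

text \<open>The rank condition supplies integer independence only; discreteness upgrades it to
  independence over the reals. If \<open>v\<close> were a real multiple \<open>s\<close> of
  \<open>u\<close>, Dirichlet approximation of \<open>s\<close> would give an integer combination of
  \<open>u\<close> and \<open>v\<close> shorter than the isolation radius \<open>e\<close> of 0,
  hence a nontrivial integer relation.\<close>

lemma lattice2_basis:
  fixes L :: "(real^2) set"
  assumes "lattice2 L"
  obtains u v where "u \<in> L" "v \<in> L" "u \<noteq> v" "independent {u, v}" "span {u, v} = UNIV"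
proof -
  interpret Z: module "\<lambda>(k::int) x::real^2. real_of_int k *\<^sub>R x"
    by unfold_locales (auto simp: algebra_simps)
  have G: "additive_subgroup L" and D: "discrete L" and R: "has_rank L 2"
    using assms by (auto simp: lattice2_def)
  from R obtain B where B: "B \<subseteq> L" "int_independent B" "card B = 2"
    by (auto simp: has_rank_def)
  then obtain u v where uv: "B = {u, v}" "u \<noteq> v" by (auto simp: card_2_iff)
  have relation_trivial: "h = 0 \<and> k = 0" if "real_of_int h *\<^sub>R u + real_of_int k *\<^sub>R v = 0" for h k :: int
  proof -
    let ?f = "\<lambda>x. if x = u then h else k"
    have "(\<Sum>x\<in>{u, v}. real_of_int (?f x) *\<^sub>R x) = 0"
      using uv that by auto
    then show ?thesis
      using Z.independentD[OF B(2), of "{u,v}" ?f u] Z.independentD[OF B(2), of "{u,v}" ?f v] uv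
      by auto
  qed
  have u0: "u \<noteq> 0" using relation_trivial[of 1 0] by auto
  have "0 isolated_in L" using D additive_subgroup_zero[OF G] by (simp add: discrete_def)
  then obtain e where e: "e > 0" "\<And>y. y \<in> L \<Longrightarrow> dist 0 y < e \<Longrightarrow> y = 0"
    by (meson isolated_in_dist_Ex_iff)
  have not_parallel: "v \<noteq> s *\<^sub>R u" for s
  proof
    assume v: "v = s *\<^sub>R u"
    obtain N :: nat where N: "norm u / e < N" using reals_Archimedean2 by blast
    have N0: "N > 0"
      using N e(1) by (metis divide_nonneg_pos less_le_not_le norm_ge_zero of_nat_0 of_nat_0_less_iff order_le_less_trans)
    obtain h k where hk: "0 < k" "\<bar>of_int k * s - of_int h\<bar> < 1 / N"
      using Dirichlet_approx[OF N0] by metis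
    define w where "w = real_of_int (-h) *\<^sub>R u + real_of_int k *\<^sub>R v"
    have "w \<in> L"
      unfolding w_def using B(1) uv by (intro additive_subgroup_add additive_subgroup_scaleR_of_int G) auto
    have "w = (of_int k * s - of_int h) *\<^sub>R u" by (simp add: w_def v algebra_simps)
    then have "norm w = \<bar>of_int k * s - of_int h\<bar> * norm u" by simp
    also have "\<dots> < 1 / N * norm u" using hk u0 by (intro mult_strict_right_mono) auto
    also have "\<dots> < e" using N N0 e(1) by (simp add: field_simps)
    finally have "w = 0" using e(2) \<open>w \<in> L\<close> by simp
    then show False using relation_trivial[of "-h" k] hk(1) by (simp add: w_def)
  qed
  have ind: "independent {v, u}"
    using u0 uv(2) not_parallel by (auto simp: independent_insert span_singleton)
  then have "UNIV \<subseteq> span {v, u}"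
    using uv(2) by (intro card_ge_dim_independent) auto
  then show thesis using B(1) uv ind that[of u v] by (auto simp: insert_commute)
qed

section \<open>Group elements of prescribed approximate direction\<close>

text \<open>Rounding the coordinates of \<open>n\<close> times \<open>d\<close> down to integers
  gives group elements \<open>b n\<close>. Divided by \<open>n\<close> they tend to
  \<open>d\<close>, and \<open>sgn\<close> is continuous at \<open>d\<close> and blind to the
  positive factor.\<close>

lemma subgroup_direction_dense:
  fixes u v d :: "'a::real_inner"
  assumes G: "additive_subgroup G" and uv: "u \<in> G" "v \<in> G" "span {u, v} = UNIV"
    and d: "norm d = 1" and \<eta>: "\<eta> > 0"
  obtains b where "b \<in> G" "b \<noteq> 0" "norm (sgn b - d) < \<eta>"
proof -
  have "d \<in> span {u, v}" using uv by simp
  then obtain \<alpha> \<beta> where ab: "d = \<alpha> *\<^sub>R u + \<beta> *\<^sub>R v"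
    by (auto simp: span_insert span_singleton algebra_simps)
  define b where "b n = real_of_int \<lfloor>real n * \<alpha>\<rfloor> *\<^sub>R u + real_of_int \<lfloor>real n * \<beta>\<rfloor> *\<^sub>R v" for n
  have bG: "b n \<in> G" for n
    unfolding b_def using uv by (intro additive_subgroup_add additive_subgroup_scaleR_of_int G)
  have fl: "(\<lambda>n. real_of_int \<lfloor>real n * c\<rfloor> / real n) \<longlonglongrightarrow> c" for c
  proof (rule tendsto_sandwich)
    show "\<forall>\<^sub>F n in sequentially. c - 1 / real n \<le> real_of_int \<lfloor>real n * c\<rfloor> / real n"
      using eventually_gt_at_top[of 0]
    proof eventually_elim
      case (elim n)
      have "real n * c - 1 \<le> real_of_int \<lfloor>real n * c\<rfloor>" by linarith
      then have "(real n * c - 1) / real n \<le> real_of_int \<lfloor>real n * c\<rfloor> / real n"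
        by (rule divide_right_mono) simp
      then show ?case using elim by (simp add: diff_divide_distrib)
    qed
    show "\<forall>\<^sub>F n in sequentially. real_of_int \<lfloor>real n * c\<rfloor> / real n \<le> c"
      using eventually_gt_at_top[of 0]
    proof eventually_elim
      case (elim n)
      have "real_of_int \<lfloor>real n * c\<rfloor> \<le> real n * c" by linarith
      then show ?case using elim by (simp add: field_simps)
    qed
    show "(\<lambda>n. c - 1 / real n) \<longlonglongrightarrow> c"
      using tendsto_diff[OF tendsto_const lim_1_over_n, of c] by simp
  qed simp
  have "(\<lambda>n. (real_of_int \<lfloor>real n * \<alpha>\<rfloor> / real n) *\<^sub>R u + (real_of_int \<lfloor>real n * \<beta>\<rfloor> / real n) *\<^sub>R v) \<longlonglongrightarrow> d"
    unfolding ab by (intro tendsto_intros fl)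
  also have "(\<lambda>n. (real_of_int \<lfloor>real n * \<alpha>\<rfloor> / real n) *\<^sub>R u + (real_of_int \<lfloor>real n * \<beta>\<rfloor> / real n) *\<^sub>R v)
      = (\<lambda>n. inverse (real n) *\<^sub>R b n)"
    by (simp add: b_def algebra_simps divide_inverse)
  finally have lim: "(\<lambda>n. inverse (real n) *\<^sub>R b n) \<longlonglongrightarrow> d" .
  have d0: "d \<noteq> 0" using d by auto
  have sgn_d: "sgn d = d" using d by (simp add: sgn_div_norm)
  have "(\<lambda>n. sgn (inverse (real n) *\<^sub>R b n)) \<longlonglongrightarrow> sgn d"
    using lim d0 by (rule tendsto_sgn)
  then have "\<forall>\<^sub>F n in sequentially. dist (sgn (inverse (real n) *\<^sub>R b n)) (sgn d) < \<eta>"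
    using \<eta> by (rule tendstoD)
  moreover have "\<forall>\<^sub>F n in sequentially. inverse (real n) *\<^sub>R b n \<noteq> 0"
    using tendsto_imp_eventually_ne[OF lim d0] .
  ultimately have "\<forall>\<^sub>F n in sequentially. b n \<noteq> 0 \<and> norm (sgn (b n) - d) < \<eta>"
    using eventually_gt_at_top[of "0::nat"]
    by eventually_elim (use sgn_d in \<open>auto simp: sgn_scaleR dist_norm\<close>)
  then show thesis using that bG by (auto dest!: eventually_happens)
qed

text \<open>If no integer combination of \<open>u\<close> and \<open>v\<close> is almost but not exactly orthogonal to \<open>b\<close>,
  then Dirichlet's theorem yields some nonzero \<open>a\<close> exactly orthogonal to \<open>b\<close>, and a
  slight change of the direction of \<open>b\<close> breaks the orthogonality.\<close>

lemma subgroup_almost_orthogonal: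
  fixes u v d :: "'a::real_inner"
  assumes G: "additive_subgroup G" and uv: "u \<in> G" "v \<in> G" "span {u, v} = UNIV"
    and ind: "independent {u, v}" "u \<noteq> v"
    and d: "norm d = 1" and \<eta>: "\<eta> > 0" and \<epsilon>: "\<epsilon> > 0"
  obtains a b where "a \<in> G" "b \<in> G" "norm (sgn b - d) < \<eta>" "0 < a \<bullet> b" "a \<bullet> b < \<epsilon> * norm b"
proof -
  obtain b where b: "b \<in> G" "b \<noteq> 0" "norm (sgn b - d) < \<eta>"
    using subgroup_direction_dense[OF G uv d \<eta>] .
  have e: "\<epsilon> * norm b > 0" using \<epsilon> b by simp
  have u0: "u \<noteq> 0" using ind dependent_zero[of "{u,v}"] by auto
  have v_ne: "v \<noteq> s *\<^sub>R u" for s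
    using ind independent_insert[of v "{u}"] by (auto simp: span_singleton insert_commute)
  obtain a where a: "a \<in> G" "a \<noteq> 0" "\<bar>a \<bullet> b\<bar> < \<epsilon> * norm b"
  proof (cases "u \<bullet> b = 0")
    case True
    then show ?thesis using that[of u] uv u0 e by simp
  next
    case False
    \<comment> \<open>With this ratio, the combination \<open>a\<close> below has inner product
      \<open>(u \<bullet> b) * (k * s - h)\<close> with \<open>b\<close>; \<open>N\<close> is large
      enough to push this below \<open>\<epsilon> * norm b\<close>.\<close>
    define s where "s = (v \<bullet> b) / (u \<bullet> b)"
    obtain N :: nat where N: "\<bar>u \<bullet> b\<bar> / (\<epsilon> * norm b) < N" using reals_Archimedean2 by blast
    have "0 < \<bar>u \<bullet> b\<bar> / (\<epsilon> * norm b)" using False e by simp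
    then have N0: "N > 0" using N by linarith
    obtain h k where hk: "0 < k" "\<bar>of_int k * s - of_int h\<bar> < 1 / N"
      using Dirichlet_approx[OF N0] by metis
    define a where "a = real_of_int k *\<^sub>R v + real_of_int (-h) *\<^sub>R u"
    have "a \<in> G"
      unfolding a_def using uv by (intro additive_subgroup_add additive_subgroup_scaleR_of_int G)
    moreover have "a \<noteq> 0"
    proof
      assume "a = 0"
      then have "real_of_int k *\<^sub>R v = real_of_int h *\<^sub>R u" by (simp add: a_def)
      then have "inverse (real_of_int k) *\<^sub>R (real_of_int k *\<^sub>R v) = inverse (real_of_int k) *\<^sub>R (real_of_int h *\<^sub>R u)" by simp
      then have "v = (real_of_int h / real_of_int k) *\<^sub>R u" using hk(1) by (simp add: field_simps)
      then show False using v_ne by blast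
    qed
    moreover have "\<bar>a \<bullet> b\<bar> < \<epsilon> * norm b"
    proof -
      have "a \<bullet> b = (u \<bullet> b) * (of_int k * s - of_int h)"
        using False by (simp add: a_def s_def algebra_simps)
      then have "\<bar>a \<bullet> b\<bar> = \<bar>u \<bullet> b\<bar> * \<bar>of_int k * s - of_int h\<bar>" by (simp add: abs_mult)
      also have "\<dots> < \<bar>u \<bullet> b\<bar> * (1 / N)" using hk False by (intro mult_strict_left_mono) auto
      also have "\<dots> < \<epsilon> * norm b" using N N0 e by (simp add: field_simps)
      finally show ?thesis .
    qed
    ultimately show ?thesis using that by blast
  qed
  obtain a b where *: "a \<in> G" "b \<in> G" "norm (sgn b - d) < \<eta>" "a \<bullet> b \<noteq> 0" "\<bar>a \<bullet> b\<bar> < \<epsilon> * norm b"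
  proof (cases "a \<bullet> b = 0")
    case False
    then show ?thesis using that a b by blast
  next
    case True
    obtain c where c: "c \<in> G" "a \<bullet> c \<noteq> 0"
    proof (rule ccontr)
      assume "\<not> thesis"
      then have "a \<bullet> u = 0" "a \<bullet> v = 0" using that uv by blast+
      moreover have "a \<in> span {u, v}" using uv by simp
      then obtain s t where "a = s *\<^sub>R u + t *\<^sub>R v"
        by (auto simp: span_insert span_singleton algebra_simps)
      then have "a \<bullet> a = a \<bullet> (s *\<^sub>R u + t *\<^sub>R v)" by simp
      ultimately have "a \<bullet> a = 0" by (simp only: inner_add_right inner_scaleR_right)
      then show False using a by simp
    qed
    \<comment> \<open>The replacement for \<open>b\<close> will be \<open>n\<close> times
      \<open>b\<close> plus \<open>c\<close>. Its direction is that of \<open>b + c / n\<close>,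
      which tends to \<open>b\<close>, and its inner product with \<open>a\<close> is
      \<open>a \<bullet> c\<close>, nonzero for every \<open>n\<close>. The smallness condition is
      homogeneous in the second vector, so it may be checked on \<open>b + c / n\<close>, where it
      holds in the limit because \<open>a \<bullet> b = 0\<close>.\<close>
    have lim: "(\<lambda>n. b + inverse (real n) *\<^sub>R c) \<longlonglongrightarrow> b + 0 *\<^sub>R c"
      by (intro tendsto_intros lim_inverse_n)
    then have "(\<lambda>n. norm (sgn (b + inverse (real n) *\<^sub>R c) - d)) \<longlonglongrightarrow> norm (sgn (b + 0 *\<^sub>R c) - d)"
      using b by (intro tendsto_norm tendsto_diff tendsto_const tendsto_sgn lim) simp
    then have 1: "\<forall>\<^sub>F n in sequentially. norm (sgn (b + inverse (real n) *\<^sub>R c) - d) < \<eta>"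
      using b by (intro order_tendstoD(2)) auto
    have "(\<lambda>n. \<bar>a \<bullet> (b + inverse (real n) *\<^sub>R c)\<bar>) \<longlonglongrightarrow> \<bar>a \<bullet> (b + 0 *\<^sub>R c)\<bar>"
      "(\<lambda>n. \<epsilon> * norm (b + inverse (real n) *\<^sub>R c)) \<longlonglongrightarrow> \<epsilon> * norm (b + 0 *\<^sub>R c)"
      by (intro tendsto_intros lim)+
    then have "(\<lambda>n. \<epsilon> * norm (b + inverse (real n) *\<^sub>R c) - \<bar>a \<bullet> (b + inverse (real n) *\<^sub>R c)\<bar>)
        \<longlonglongrightarrow> \<epsilon> * norm b"
      using True by (auto dest: tendsto_diff)
    then have 2: "\<forall>\<^sub>F n in sequentially. \<epsilon> * norm (b + inverse (real n) *\<^sub>R c) - \<bar>a \<bullet> (b + inverse (real n) *\<^sub>R c)\<bar> > 0"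
      using e by (rule order_tendstoD(1))
    obtain n :: nat where n: "n > 0" "norm (sgn (b + inverse (real n) *\<^sub>R c) - d) < \<eta>"
        "\<bar>a \<bullet> (b + inverse (real n) *\<^sub>R c)\<bar> < \<epsilon> * norm (b + inverse (real n) *\<^sub>R c)"
      using eventually_happens[OF eventually_conj[OF eventually_gt_at_top[of 0] eventually_conj[OF 1 2]]]
      by auto
    define b' where "b' = real_of_int (int n) *\<^sub>R b + c"
    have b': "b' = real n *\<^sub>R (b + inverse (real n) *\<^sub>R c)"
      using n(1) by (simp add: b'_def algebra_simps)
    show ?thesis
    proof (rule that[of a b'])
      show "b' \<in> G" unfolding b'_def
        using b c by (intro additive_subgroup_add additive_subgroup_scaleR_of_int G)
      show "norm (sgn b' - d) < \<eta>" using n by (simp add: b' sgn_scaleR)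
      show "a \<bullet> b' \<noteq> 0" using True c by (simp add: b'_def inner_right_distrib)
      show "\<bar>a \<bullet> b'\<bar> < \<epsilon> * norm b'" unfolding b' using n
        by (simp only: inner_scaleR_right norm_scaleR abs_mult) (simp add: mult.left_commute)
    qed (use a in auto)
  qed
  show thesis
  proof (cases "a \<bullet> b > 0")
    case True
    then show thesis using * that by simp
  next
    case False
    then show thesis using * that[of "- a" b] additive_subgroup_minus[OF G] by simp
  qed
qed

section \<open>Norms of group elements in a sector\<close>

text \<open>Far out along \<open>b\<close>, adding \<open>c\<close> lengthens a vector by about the
  component \<open>p\<close> of \<open>c\<close> along \<open>b\<close>. Cauchy-Schwarz against
  \<open>b\<close> gives the lower bound; the upper bound exceeds it by an error of order
  \<open>1 / n\<close>, coming from the part of \<open>c\<close> orthogonal to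
  \<open>b\<close>.\<close>

lemma norm_add_scaleR_increment_tendsto:
  fixes b c :: "'a::real_inner"
  assumes b: "b \<noteq> 0"
  shows "(\<lambda>n. norm (real n *\<^sub>R b + c) - real n * norm b) \<longlonglongrightarrow> c \<bullet> b / norm b"
proof (rule tendsto_sandwich)
  define p where "p = c \<bullet> b / norm b"
  have nb: "norm b > 0" using b by simp
  have cb: "c \<bullet> b = p * norm b" using b by (simp add: p_def)
  have proj: "norm (real n *\<^sub>R b + c) \<ge> real n * norm b + p" for n
  proof -
    have "(real n * norm b + p) * norm b = (real n *\<^sub>R b + c) \<bullet> b"
      using cb by (simp add: inner_left_distrib dot_square_norm power2_eq_square algebra_simps)
    also have "\<dots> \<le> norm (real n *\<^sub>R b + c) * norm b" by (rule norm_cauchy_schwarz)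
    finally show ?thesis using nb by simp
  qed
  then show "\<forall>\<^sub>F n in sequentially. c \<bullet> b / norm b \<le> norm (real n *\<^sub>R b + c) - real n * norm b"
    by (simp add: p_def le_diff_eq add.commute)
  have big: "filterlim (\<lambda>n. real n * norm b + p) at_top sequentially"
    unfolding add.commute[of _ p]
    using nb by (intro filterlim_tendsto_add_at_top[OF tendsto_const]
      filterlim_at_top_mult_tendsto_pos[OF tendsto_const] filterlim_real_sequentially)
  show "\<forall>\<^sub>F n in sequentially. norm (real n *\<^sub>R b + c) - real n * norm b
      \<le> c \<bullet> b / norm b + (norm c)\<^sup>2 / (2 * (real n * norm b + p))"
    using filterlim_at_top_dense[THEN iffD1, OF big, rule_format, of 0]
  proof eventually_elim
    case (elim n)
    define s where "s = real n * norm b + p"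
    have s: "s > 0" using elim by (simp add: s_def)
    have "(norm (real n *\<^sub>R b + c))\<^sup>2 = (real n *\<^sub>R b + c) \<bullet> (real n *\<^sub>R b + c)"
      by (simp add: dot_square_norm)
    also have "\<dots> = (real n * norm b)\<^sup>2 + 2 * real n * (c \<bullet> b) + (norm c)\<^sup>2"
      unfolding power_mult_distrib power2_norm_eq_inner
      by (simp add: inner_left_distrib inner_right_distrib inner_commute power2_eq_square)
    \<comment> \<open>The square of \<open>s\<close> exceeds the first two terms by the square of
      \<open>p\<close>. The next line completes the square, so that the root can be taken.\<close>
    also have "\<dots> \<le> s\<^sup>2 + (norm c)\<^sup>2"
      by (simp add: s_def cb power2_eq_square algebra_simps)
    also have "\<dots> \<le> (s + (norm c)\<^sup>2 / (2 * s))\<^sup>2"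
      using s by (simp add: power2_sum)
    finally have "norm (real n *\<^sub>R b + c) \<le> s + (norm c)\<^sup>2 / (2 * s)"
      by (rule power2_le_imp_le) (use s in simp)
    then show ?case by (simp add: s_def p_def)
  qed
  have "filterlim (\<lambda>n. 2 * (real n * norm b + p)) at_top sequentially"
    by (intro filterlim_tendsto_pos_mult_at_top[OF tendsto_const _ big]) simp
  then have "((\<lambda>n. (norm c)\<^sup>2 / (2 * (real n * norm b + p))) \<longlongrightarrow> 0) sequentially"
    by (intro tendsto_divide_0[OF tendsto_const] filterlim_at_top_imp_at_infinity)
  from tendsto_add[OF tendsto_const this]
  show "(\<lambda>n. c \<bullet> b / norm b + (norm c)\<^sup>2 / (2 * (real n * norm b + p))) \<longlonglongrightarrow> c \<bullet> b / norm b"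
    by simp
qed simp

text \<open>The norms of the vectors \<open>n *\<^sub>R b + j *\<^sub>R a\<close> with \<open>j \<le> J\<close> climb in small steps from
  \<open>n * norm b\<close> to beyond \<open>(n + 1) * norm b\<close>.\<close>

lemma subgroup_norms_sector_dense:
  fixes a b d :: "'a::real_inner"
  assumes G: "additive_subgroup G" and ab: "a \<in> G" "b \<in> G" and sgn_b: "norm (sgn b - d) < \<eta>"
    and pos: "0 < a \<bullet> b" and small: "a \<bullet> b < \<epsilon> * norm b"
  obtains R where "\<And>r. r \<ge> R \<Longrightarrow> \<exists>w\<in>G. norm (sgn w - d) < \<eta> \<and> \<bar>norm w - r\<bar> < \<epsilon>"
proof -
  have b0: "b \<noteq> 0" using pos by auto
  then have nb: "norm b > 0" by simp
  define w where "w n j = real n *\<^sub>R b + real j *\<^sub>R a" for n j :: nat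
  have wG: "w n j \<in> G" for n j
    unfolding w_def using additive_subgroup_scaleR_of_int[OF G, of _ "int _"] ab
    by (intro additive_subgroup_add G) auto
  \<comment> \<open>\<open>J\<close> additions of \<open>a\<close> advance the component along
    \<open>b\<close> by more than \<open>norm b\<close>, which carries the norm past the whole gap
    between consecutive multiples of \<open>b\<close>.\<close>
  obtain J :: nat where J: "(norm b)\<^sup>2 / (a \<bullet> b) < J" using reals_Archimedean2 by blast
  have "\<forall>\<^sub>F n in sequentially. norm (sgn (w n j) - d) < \<eta> \<and> norm (w n (Suc j)) - norm (w n j) < \<epsilon>" for j
  proof -
    have lim: "(\<lambda>n. b + inverse (real n) *\<^sub>R (real j *\<^sub>R a)) \<longlonglongrightarrow> b + 0 *\<^sub>R (real j *\<^sub>R a)"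
      by (intro tendsto_intros lim_inverse_n)
    then have "(\<lambda>n. norm (sgn (b + inverse (real n) *\<^sub>R (real j *\<^sub>R a)) - d)) \<longlonglongrightarrow> norm (sgn (b + 0 *\<^sub>R (real j *\<^sub>R a)) - d)"
      using b0 by (intro tendsto_norm tendsto_diff tendsto_const tendsto_sgn lim) simp
    then have 1: "\<forall>\<^sub>F n in sequentially. norm (sgn (b + inverse (real n) *\<^sub>R (real j *\<^sub>R a)) - d) < \<eta>"
      using sgn_b by (intro order_tendstoD(2)) auto
    \<comment> \<open>Both norms are compared with the same \<open>n * norm b\<close>, so their
      difference, the length of one climbing step, tends to \<open>a \<bullet> b / norm b\<close>,
      which is below \<open>\<epsilon>\<close>.\<close>
    have "(\<lambda>n. (norm (w n (Suc j)) - real n * norm b) - (norm (w n j) - real n * norm b))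
        \<longlonglongrightarrow> (real (Suc j) *\<^sub>R a) \<bullet> b / norm b - (real j *\<^sub>R a) \<bullet> b / norm b"
      unfolding w_def by (intro tendsto_diff norm_add_scaleR_increment_tendsto b0)
    also have "(real (Suc j) *\<^sub>R a) \<bullet> b / norm b - (real j *\<^sub>R a) \<bullet> b / norm b = (a \<bullet> b) / norm b"
      by (simp add: add_divide_distrib distrib_right)
    finally have "\<forall>\<^sub>F n in sequentially. norm (w n (Suc j)) - real n * norm b - (norm (w n j) - real n * norm b) < \<epsilon>"
      using small nb by (intro order_tendstoD(2)) (auto simp: field_simps)
    with 1 eventually_gt_at_top[of "0::nat"] show ?thesis
    proof eventually_elim
      case (elim n)
      have "w n j = real n *\<^sub>R (b + inverse (real n) *\<^sub>R (real j *\<^sub>R a))"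
        using elim by (simp add: w_def algebra_simps)
      then show ?case using elim by (simp add: sgn_scaleR)
    qed
  qed
  \<comment> \<open>Only the finitely many \<open>j\<close> up to \<open>J\<close> occur, so one
    threshold \<open>n0\<close> serves them all.\<close>
  then have "\<forall>\<^sub>F n in sequentially. \<forall>j\<in>{..J}. norm (sgn (w n j) - d) < \<eta> \<and> norm (w n (Suc j)) - norm (w n j) < \<epsilon>"
    by (intro eventually_ball_finite) auto
  then obtain n0 where n0: "\<And>n j. n \<ge> n0 \<Longrightarrow> j \<le> J \<Longrightarrow>
      norm (sgn (w n j) - d) < \<eta> \<and> norm (w n (Suc j)) - norm (w n j) < \<epsilon>"
    by (auto simp: eventually_sequentially)
  show thesis
  proof (rule that[of "real n0 * norm b"])
    fix r assume r: "real n0 * norm b \<le> r"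
    define n where "n = nat \<lfloor>r / norm b\<rfloor>"
    have rb: "real n0 \<le> r / norm b" using r nb by (simp add: field_simps)
    then have n: "n \<ge> n0" unfolding n_def by (simp add: le_nat_floor)
    have "0 \<le> r / norm b" using rb by (meson of_nat_0_le_iff order_trans)
    then have "real n \<le> r / norm b" "r / norm b < real n + 1" unfolding n_def by linarith+
    then have nr: "real n * norm b \<le> r" "r < (real n + 1) * norm b" using nb by (auto simp: field_simps)
    have "(real n + 1) * norm b \<le> norm (w n J)"
    proof -
      have "((real n + 1) * norm b) * norm b = real n * (norm b)\<^sup>2 + (norm b)\<^sup>2"
        by (simp add: algebra_simps power2_eq_square)
      also have "\<dots> \<le> real n * (norm b)\<^sup>2 + real J * (a \<bullet> b)"
        using J pos by (simp add: field_simps)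
      also have "\<dots> = w n J \<bullet> b" by (simp add: w_def inner_left_distrib dot_square_norm)
      also have "\<dots> \<le> norm (w n J) * norm b" by (rule norm_cauchy_schwarz)
      finally show ?thesis using nb by simp
    qed
    then have "r < norm (w n J)" using nr by simp
    \<comment> \<open>Take the first step that overshoots \<open>r\<close>. The vector just before
      it has norm at most \<open>r\<close>, and misses \<open>r\<close> by less than the length of
      that one step.\<close>
    define k where "k = (LEAST k. r < norm (w n k))"
    have k: "r < norm (w n k)" "k \<le> J"
      unfolding k_def using \<open>r < norm (w n J)\<close> by (auto intro: LeastI Least_le)
    have "norm (w n 0) \<le> r" using nr by (simp add: w_def)
    then have "k \<noteq> 0" using k by (metis not_le)
    then obtain j where j: "k = Suc j" using not0_implies_Suc by blast
    have "norm (w n j) \<le> r" using not_less_Least[of j "\<lambda>k. r < norm (w n k)"] j by (auto simp flip: k_def)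
    moreover have "norm (sgn (w n j) - d) < \<eta>" "norm (w n (Suc j)) - norm (w n j) < \<epsilon>"
      using n0[OF n, of j] k j by auto
    ultimately show "\<exists>w\<in>G. norm (sgn w - d) < \<eta> \<and> \<bar>norm w - r\<bar> < \<epsilon>"
      using k j by (intro bexI[OF _ wG[of n j]]) auto
  qed
qed

section \<open>A uniform threshold over all directions\<close>

text \<open>Each direction \<open>d\<close> has its own threshold \<open>R d\<close>. Finitely many
  balls of radius \<open>\<delta> / 2\<close> cover the circle, so finitely many thresholds suffice;
  the other half of \<open>\<delta>\<close> pays for replacing the direction of \<open>x\<close> by
  a centre.\<close>

lemma lattice2_approximates_far_points:
  assumes L: "lattice2 L" and \<epsilon>: "\<epsilon> > 0" and \<delta>: "\<delta> > 0"
  obtains R where "R > 0"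
    "\<And>x. norm x \<ge> R \<Longrightarrow> \<exists>w\<in>L. w \<noteq> 0 \<and> norm (sgn x - sgn w) < \<delta> \<and> \<bar>norm x - norm w\<bar> < \<epsilon>"
proof -
  have G: "additive_subgroup L" using L by (simp add: lattice2_def)
  obtain u v where uv: "u \<in> L" "v \<in> L" "u \<noteq> v" "independent {u, v}" "span {u, v} = UNIV"
    using lattice2_basis[OF L] .
  have "\<exists>R. \<forall>r\<ge>R. \<exists>w\<in>L. norm (sgn w - d) < \<delta> / 2 \<and> \<bar>norm w - r\<bar> < \<epsilon>" if d: "norm d = 1" for d
  proof -
    obtain a b where "a \<in> L" "b \<in> L" "norm (sgn b - d) < \<delta> / 2" "0 < a \<bullet> b" "a \<bullet> b < \<epsilon> * norm b"
      using subgroup_almost_orthogonal[OF G uv(1,2,5,4,3) d, of "\<delta> / 2" \<epsilon>] \<delta> \<epsilon> by auto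
    then show ?thesis using subgroup_norms_sector_dense[OF G] by metis
  qed
  then obtain R where R: "\<And>d r. norm d = 1 \<Longrightarrow> r \<ge> R d \<Longrightarrow>
      \<exists>w\<in>L. norm (sgn w - d) < \<delta> / 2 \<and> \<bar>norm w - r\<bar> < \<epsilon>"
    by metis
  obtain D where D: "D \<subseteq> sphere (0::real^2) 1" "finite D" "sphere 0 1 \<subseteq> (\<Union>d\<in>D. ball d (\<delta> / 2))"
    by (rule compactE_image[OF compact_sphere, of "sphere 0 1" "\<lambda>d. ball d (\<delta> / 2)"]) (use \<delta> in auto)
  \<comment> \<open>The sum dominates every \<open>R d\<close> with \<open>d\<close> in
    \<open>D\<close>. The summand \<open>\<epsilon>\<close> ensures
    \<open>norm x \<ge> \<epsilon>\<close>, so that a vector \<open>w\<close> with norm within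
    \<open>\<epsilon>\<close> of \<open>norm x\<close> cannot vanish.\<close>
  define M where "M = \<epsilon> + (\<Sum>d\<in>D. \<bar>R d\<bar>)"
  have s0: "(\<Sum>d\<in>D. \<bar>R d\<bar>) \<ge> 0" by (simp add: sum_nonneg)
  show thesis
  proof (rule that[of M])
    show "M > 0" using s0 \<epsilon> unfolding M_def by linarith
    fix x :: "real^2" assume x: "M \<le> norm x"
    then have "x \<noteq> 0" using \<open>M > 0\<close> by auto
    then have "sgn x \<in> sphere 0 1" by (simp add: norm_sgn)
    then obtain d where d: "d \<in> D" "dist d (sgn x) < \<delta> / 2" using D(3) by auto
    have "R d \<le> \<bar>R d\<bar>" by simp
    also have "\<dots> \<le> (\<Sum>d\<in>D. \<bar>R d\<bar>)" using D(2) d(1) by (intro member_le_sum) auto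
    also have "\<dots> \<le> norm x" using x \<epsilon> by (simp add: M_def)
    finally obtain w where w: "w \<in> L" "norm (sgn w - d) < \<delta> / 2" "\<bar>norm w - norm x\<bar> < \<epsilon>"
      using R[of d "norm x"] D(1) d(1) by (metis dist_0_norm mem_sphere subsetD)
    have "norm w > 0" using w(3) x s0 unfolding M_def by linarith
    then have "w \<noteq> 0" by simp
    moreover have "norm (sgn x - sgn w) < \<delta>"
      using norm_triangle_ineq[of "sgn x - d" "d - sgn w"] d(2) w(2) by (simp add: dist_norm norm_minus_commute)
    ultimately show "\<exists>w\<in>L. w \<noteq> 0 \<and> norm (sgn x - sgn w) < \<delta> \<and> \<bar>norm x - norm w\<bar> < \<epsilon>"
      using w by (auto simp: abs_minus_commute)
  qed
qed

section \<open>Rotations of the plane\<close>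

lemma norm_rotation: "norm (rotation t x) = norm x"
proof -
  have "(cos t * a - sin t * b)\<^sup>2 + (sin t * a + cos t * b)\<^sup>2 = ((sin t)\<^sup>2 + (cos t)\<^sup>2) * (a\<^sup>2 + b\<^sup>2)" for a b
    by algebra
  then show ?thesis
    by (simp add: rotation_def norm_vec_def L2_set_def matrix_vector_mult_def sum_2)
qed

lemma rotation_add: "rotation t (x + y) = rotation t x + rotation t y"
  by (simp add: rotation_def matrix_vector_right_distrib)

lemma rotation_rotation_minus: "rotation t (rotation (- t) x) = x"
proof -
  have "cos t * (cos t * c) + sin t * (sin t * c) = c" for c
    using sin_cos_squared_add[of t] by algebra
  from this[of "x $ 1"] this[of "x $ 2"] show ?thesis
    by (simp add: rotation_def vec_eq_iff forall_2 matrix_vector_mult_def sum_2 algebra_simps)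
qed

text \<open>Rotations are isometries, so the error left after rotating \<open>w\<close> can be
  rotated back and absorbed into the thickening of the lattice.\<close>

lemma mem_rotate_set_thicken:
  assumes "cis t \<in> \<Theta>" "w \<in> L" "norm (x - rotation t w) < \<epsilon>"
  shows "x \<in> rotate_set \<Theta> (thicken L \<epsilon>)"
proof -
  define y where "y = rotation (- t) (x - rotation t w)"
  have "rotation t (w + y) = x" by (simp add: y_def rotation_add rotation_rotation_minus)
  moreover have "w + y \<in> thicken L \<epsilon>"
    using assms by (force simp: thicken_def y_def norm_rotation)
  ultimately show ?thesis using assms(1) unfolding rotate_set_def by blast
qed

text \<open>Under the identification \<open>c\<close> of the plane with the complex numbers,
  \<open>rotation t\<close> is multiplication by \<open>cis t\<close>. The quotient \<open>q\<close>
  of the two unit vectors is therefore the required rotation, and dividing by a unit vector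
  preserves the chord length.\<close>

lemma rotation_aligning:
  fixes x w :: "real^2"
  assumes x: "x \<noteq> 0" and w: "w \<noteq> 0"
  obtains t where "rotation t w = norm w *\<^sub>R sgn x" "norm (cis t - 1) = norm (sgn x - sgn w)"
proof -
  define c where "c y = Complex (y $ 1) (y $ 2)" for y :: "real^2"
  have norm_c: "norm (c y) = norm y" for y
    by (simp add: c_def norm_vec_def L2_set_def sum_2 cmod_def)
  have c_diff: "c (y - z) = c y - c z" and c_scaleR: "c (r *\<^sub>R y) = of_real r * c y" for y z r
    by (simp_all add: c_def complex_eq_iff)
  have c_rotation: "c (rotation t y) = cis t * c y" for t y
    by (simp add: c_def rotation_def complex_eq_iff matrix_vector_mult_def sum_2)
  have c_inj: "c y = c z \<Longrightarrow> y = z" for y z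
    by (simp add: c_def vec_eq_iff forall_2)
  define q where "q = c (sgn x) / c (sgn w)"
  have nq: "norm q = 1" using x w by (simp add: q_def norm_divide norm_c norm_sgn)
  then have q: "cis (Arg q) = q"
    by (metis cis_Arg div_by_1 norm_zero of_real_1 sgn_eq zero_neq_one)
  have cw: "c (sgn w) \<noteq> 0" using w norm_c[of "sgn w"] by (auto simp: norm_sgn)
  have ww: "c w = of_real (norm w) * c (sgn w)"
    using w by (simp add: sgn_div_norm flip: c_scaleR)
  have "c (rotation (Arg q) w) = c (norm w *\<^sub>R sgn x)"
    using cw by (simp add: c_rotation q c_scaleR ww) (simp add: q_def)
  then have 1: "rotation (Arg q) w = norm w *\<^sub>R sgn x" by (rule c_inj)
  have "q - 1 = c (sgn x - sgn w) / c (sgn w)" using cw by (simp add: q_def c_diff diff_divide_distrib)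
  then have "norm (q - 1) = norm (sgn x - sgn w)" using w by (simp add: norm_divide norm_c norm_sgn)
  then show thesis using 1 that[of "Arg q"] by (simp add: q)
qed

section \<open>Finitely many rotations for a compact annulus\<close>

text \<open>Turning the nearby lattice vector onto the ray of \<open>x\<close> costs a rotation
  close to 1. The sets \<open>U t\<close> reached by such rotations are open and cover the annulus,
  so compactness leaves finitely many.\<close>

lemma annulus_finite_rotations:
  fixes L :: "(real^2) set" and R R' :: real
  assumes far: "\<And>x. norm x \<ge> R \<Longrightarrow> \<exists>w\<in>L. w \<noteq> 0 \<and> norm (sgn x - sgn w) < \<delta> \<and> \<bar>norm x - norm w\<bar> < \<epsilon>"
    and R: "R > 0"
  obtains T where "finite T" "\<And>t. t \<in> T \<Longrightarrow> norm (cis t - 1) < \<delta>"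
    "\<And>x. R \<le> norm x \<Longrightarrow> norm x \<le> R' \<Longrightarrow> x \<in> rotate_set (cis ` T) (thicken L \<epsilon>)"
proof -
  define K where "K = cball 0 R' - ball (0::real^2) R"
  have K: "compact K" unfolding K_def by (intro compact_diff) auto
  define U where "U t = (\<Union>w\<in>L. ball (rotation t w) \<epsilon>)" for t
  have "K \<subseteq> (\<Union>t\<in>{t. norm (cis t - 1) < \<delta>}. U t)"
  proof
    fix x assume "x \<in> K"
    then have x: "norm x \<ge> R" by (simp add: K_def)
    then have x0: "x \<noteq> 0" using R by auto
    obtain w where w: "w \<in> L" "w \<noteq> 0" "norm (sgn x - sgn w) < \<delta>" "\<bar>norm x - norm w\<bar> < \<epsilon>"
      using far[OF x] by blast
    obtain t where t: "rotation t w = norm w *\<^sub>R sgn x" "norm (cis t - 1) = norm (sgn x - sgn w)"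
      using rotation_aligning[OF x0 w(2)] .
    \<comment> \<open>After alignment the remaining error is purely radial, namely the difference of
      the norms.\<close>
    have "norm x *\<^sub>R sgn x = x" using x0 by (simp add: sgn_div_norm)
    then have "rotation t w - x = (norm w - norm x) *\<^sub>R sgn x"
      by (simp add: t scaleR_diff_left)
    then have "norm (rotation t w - x) = \<bar>norm w - norm x\<bar>" using x0 by (simp add: norm_sgn)
    then have "x \<in> ball (rotation t w) \<epsilon>" using w(4) by (simp add: dist_norm abs_minus_commute)
    then have "x \<in> U t" using w(1) by (auto simp: U_def)
    then show "x \<in> (\<Union>t\<in>{t. norm (cis t - 1) < \<delta>}. U t)" using t(2) w(3) by force
  qed
  moreover have "open (U t)" for t by (auto simp: U_def)
  ultimately obtain T where T: "T \<subseteq> {t. norm (cis t - 1) < \<delta>}" "finite T" "K \<subseteq> (\<Union>t\<in>T. U t)"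
    using compactE_image[OF K, of "{t. norm (cis t - 1) < \<delta>}" U] by metis
  show thesis
  proof (rule that[of T])
    fix x :: "real^2" assume "R \<le> norm x" "norm x \<le> R'"
    then have "x \<in> K" by (simp add: K_def)
    then obtain t w where "t \<in> T" "w \<in> L" "dist (rotation t w) x < \<epsilon>"
      using T(3) by (auto simp: U_def)
    then show "x \<in> rotate_set (cis ` T) (thicken L \<epsilon>)"
      by (intro mem_rotate_set_thicken[of t _ w]) (auto simp: dist_norm norm_minus_commute)
  qed (use T in auto)
qed

section \<open>Listing shrinking finite sets as a convergent sequence\<close>

text \<open>Enumerating pairs of a level and a point makes the order irrelevant: each pair occurs
  once, and only finitely many pairs have a point at distance at least \<open>e\<close> from
  \<open>l\<close>. Adding \<open>l\<close> to every level makes the index set infinite even if all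
  \<open>F k\<close> are empty.\<close>

lemma enumerate_shrinking_finite_sets:
  fixes F :: "nat \<Rightarrow> 'a::metric_space set"
  assumes fin: "\<And>k. finite (F k)" and near: "\<And>k x. x \<in> F k \<Longrightarrow> dist x l < \<delta> k" and \<delta>: "\<delta> \<longlonglongrightarrow> 0"
  obtains \<theta> :: "nat \<Rightarrow> 'a" where "\<theta> \<longlonglongrightarrow> l" "range \<theta> = insert l (\<Union>k. F k)"
proof -
  define I where "I = (SIGMA k:UNIV. insert l (F k))"
  have "range (\<lambda>k. (k, l)) \<subseteq> I" by (auto simp: I_def)
  moreover have "infinite (range (\<lambda>k::nat. (k, l)))" by (intro range_inj_infinite injI) auto
  ultimately have "infinite I" using finite_subset by blast
  moreover have "countable I" unfolding I_def using fin by (intro countable_SIGMA) (auto intro: countable_finite)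
  ultimately have bij: "bij_betw (from_nat_into I) UNIV I" by (intro bij_betw_from_nat_into)
  define \<theta> where "\<theta> = snd \<circ> from_nat_into I"
  have "range \<theta> = snd ` I" using bij by (simp add: \<theta>_def bij_betw_def flip: image_image image_comp)
  also have "\<dots> = insert l (\<Union>k. F k)" by (force simp: I_def)
  finally have range: "range \<theta> = insert l (\<Union>k. F k)" .
  have "\<theta> \<longlonglongrightarrow> l"
  proof (rule tendstoI)
    fix e :: real assume e: "e > 0"
    then obtain K where K: "\<And>k. k \<ge> K \<Longrightarrow> \<delta> k < e"
      using order_tendstoD(2)[OF \<delta>] by (auto simp: eventually_sequentially)
    \<comment> \<open>A point at distance at least \<open>e\<close> from \<open>l\<close> differs
      from \<open>l\<close>, hence lies in some \<open>F k\<close>; then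
      \<open>e < \<delta> k\<close>, which forces \<open>k < K\<close>.\<close>
    have "{n. \<not> dist (\<theta> n) l < e} \<subseteq> from_nat_into I -` (SIGMA k:{..<K}. F k)"
    proof safe
      fix n assume n: "\<not> dist (\<theta> n) l < e"
      obtain k y where ky: "from_nat_into I n = (k, y)" by force
      then have "(k, y) \<in> I" using bij by (metis bij_betwE UNIV_I)
      moreover have "\<theta> n = y" by (simp add: \<theta>_def ky)
      ultimately have "y \<in> F k" using n e by (auto simp: I_def)
      moreover have "k < K" using near[OF \<open>y \<in> F k\<close>] K[of k] n \<open>\<theta> n = y\<close> by force
      ultimately show "n \<in> from_nat_into I -` (SIGMA k:{..<K}. F k)" using ky by simp
    qed
    moreover have "finite (from_nat_into I -` (SIGMA k:{..<K}. F k))"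
      using bij fin by (intro finite_vimageI finite_SigmaI) (auto simp: bij_betw_def)
    ultimately show "\<forall>\<^sub>F n in sequentially. dist (\<theta> n) l < e"
      unfolding cofinite_eq_sequentially[symmetric] eventually_cofinite using finite_subset by blast
  qed
  then show thesis using range that by blast
qed

section \<open>Assembling one sequence for all radii\<close>

theorem corollary3:
  fixes \<Lambda> :: "(real^2) set"
  assumes "lattice2 \<Lambda>"
  shows "\<exists>\<theta> :: nat \<Rightarrow> complex.
           (\<forall>n. \<theta> n \<in> unit_circle) \<and>
           (\<exists>l\<in>unit_circle. \<theta> \<longlonglongrightarrow> l) \<and>
           (\<forall>\<epsilon>>0. good \<Lambda> \<epsilon> (closure (range \<theta>)))"
proof -
  define \<delta> where "\<delta> k = 1 / real (Suc k)" for k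
  have \<delta>0: "\<delta> k > 0" for k by (simp add: \<delta>_def)
  have \<delta>_lim: "\<delta> \<longlonglongrightarrow> 0" unfolding \<delta>_def by (rule LIMSEQ_Suc[OF lim_1_over_n])
  have "\<exists>R>0. \<forall>x. norm x \<ge> R \<longrightarrow>
      (\<exists>w\<in>\<Lambda>. w \<noteq> 0 \<and> norm (sgn x - sgn w) < \<delta> k \<and> \<bar>norm x - norm w\<bar> < \<delta> k)" for k
    using lattice2_approximates_far_points[OF assms \<delta>0 \<delta>0, of k k] by metis
  then obtain R where R: "\<And>k. R k > 0"
    "\<And>k x. norm x \<ge> R k \<Longrightarrow>
      \<exists>w\<in>\<Lambda>. w \<noteq> 0 \<and> norm (sgn x - sgn w) < \<delta> k \<and> \<bar>norm x - norm w\<bar> < \<delta> k"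
    by metis
  \<comment> \<open>The thresholds \<open>R\<close> need not increase. Their partial sums do, stay
    above \<open>R k\<close>, and with \<open>k\<close> added tend to infinity, so the annuli
    between consecutive \<open>S k\<close> exhaust the plane outside the first radius.\<close>
  define S where "S k = real k + (\<Sum>i\<le>k. R i)" for k
  have S_ge: "R k \<le> S k" "real k \<le> S k" for k
  proof -
    have "R k \<le> (\<Sum>i\<le>k. R i)" using R(1) by (intro member_le_sum) (auto intro: less_imp_le)
    then show "R k \<le> S k" by (simp add: S_def)
    show "real k \<le> S k" using R(1) by (simp add: S_def sum_nonneg less_imp_le)
  qed
  have "\<exists>T. finite T \<and> (\<forall>t\<in>T. norm (cis t - 1) < \<delta> k) \<and>
      (\<forall>x. S k \<le> norm x \<longrightarrow> norm x \<le> S (Suc k) \<longrightarrow> x \<in> rotate_set (cis ` T) (thicken \<Lambda> (\<delta> k)))" for k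
  proof -
    obtain T where "finite T" "\<And>t. t \<in> T \<Longrightarrow> norm (cis t - 1) < \<delta> k"
      "\<And>x. R k \<le> norm x \<Longrightarrow> norm x \<le> S (Suc k) \<Longrightarrow> x \<in> rotate_set (cis ` T) (thicken \<Lambda> (\<delta> k))"
      using annulus_finite_rotations[OF R(2) R(1)] by blast
    then show ?thesis using S_ge(1)[of k] by (intro exI[of _ T]) (auto intro: order_trans)
  qed
  then obtain T where T: "\<And>k. finite (T k)" "\<And>k t. t \<in> T k \<Longrightarrow> norm (cis t - 1) < \<delta> k"
    "\<And>k x. S k \<le> norm x \<Longrightarrow> norm x \<le> S (Suc k) \<Longrightarrow> x \<in> rotate_set (cis ` T k) (thicken \<Lambda> (\<delta> k))"
    by metis
  \<comment> \<open>The angles of all levels go into a single sequence, chosen before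
    \<open>\<epsilon>\<close>; its limit 1 is the trivial rotation.\<close>
  obtain \<theta> where \<theta>: "\<theta> \<longlonglongrightarrow> 1" "range \<theta> = insert 1 (\<Union>k. cis ` T k)"
    by (rule enumerate_shrinking_finite_sets[of "\<lambda>k. cis ` T k" 1 \<delta>]) (use T \<delta>_lim in \<open>auto simp: dist_norm\<close>)
  have circle: "range \<theta> \<subseteq> unit_circle" unfolding \<theta>(2) by auto
  have "good \<Lambda> \<epsilon> (closure (range \<theta>))" if \<epsilon>: "\<epsilon> > 0" for \<epsilon>
  proof -
    \<comment> \<open>From this level on the precision is finer than \<open>\<epsilon>\<close>, so
      the excluded disk only has to swallow the earlier annuli.\<close>
    obtain k where k: "\<And>j. j \<ge> k \<Longrightarrow> \<delta> j < \<epsilon>"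
      using order_tendstoD(2)[OF \<delta>_lim \<epsilon>] by (auto simp: eventually_sequentially)
    show ?thesis unfolding good_def
    proof (intro conjI exI)
      show "closure (range \<theta>) \<subseteq> unit_circle" using circle by (rule closure_minimal) simp
      show "0 < R k + S k" using R(1)[of k] S_ge(2)[of k] by simp
      show "- ball 0 (R k + S k) \<subseteq> rotate_set (closure (range \<theta>)) (thicken \<Lambda> \<epsilon>)"
      proof
        fix x :: "real^2" assume "x \<in> - ball 0 (R k + S k)"
        then have x: "S k \<le> norm x" using R(1)[of k] by simp
        obtain m :: nat where "norm x < m" using reals_Archimedean2 by blast
        then have ex: "norm x < S m" using S_ge(2)[of m] by simp
        \<comment> \<open>The least such \<open>p\<close> locates \<open>x\<close> in the annulus
          from \<open>S (p - 1)\<close> to \<open>S p\<close>; monotonicity of \<open>S\<close> and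
          \<open>S k \<le> norm x\<close> give \<open>p - 1 \<ge> k\<close>.\<close>
        define p where "p = (LEAST p. norm x < S p)"
        have p: "norm x < S p" unfolding p_def using ex by (rule LeastI)
        have mono: "S i \<le> S j" if "i \<le> j" for i j
          unfolding S_def using that R(1) by (intro add_mono sum_mono2) (auto intro: less_imp_le)
        have "k < p" using mono[of p k] p x by linarith
        then obtain j where j: "p = Suc j" "k \<le> j" by (cases p) auto
        have "S j \<le> norm x" using not_less_Least[of j "\<lambda>p. norm x < S p"] j by (auto simp flip: p_def)
        then have "x \<in> rotate_set (cis ` T j) (thicken \<Lambda> (\<delta> j))" using T(3)[of j x] p j by simp
        moreover have "cis ` T j \<subseteq> closure (range \<theta>)" using closure_subset[of "range \<theta>"] \<theta>(2) by blast
        moreover have "thicken \<Lambda> (\<delta> j) \<subseteq> thicken \<Lambda> \<epsilon>" using k[OF j(2)] by (force simp: thicken_def)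
        ultimately show "x \<in> rotate_set (closure (range \<theta>)) (thicken \<Lambda> \<epsilon>)"
          unfolding rotate_set_def by blast
      qed
    qed
  qed
  moreover have "\<theta> n \<in> unit_circle" for n using circle by blast
  moreover have "1 \<in> unit_circle" by simp
  ultimately show ?thesis using \<theta>(1) by blast
qed

end
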